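(* Let $n \ge 1$ and let $\mathcal{A}$ be a union-closed family with universe $[n]=\{1,\dots,n\}$ and length $\ell$. Then \[|\mathcal{A}| \le \sum_{i=0}^{\ell}\binom{n}{i},\] with equality if and only if $\mathcal{A} = \bigcup_{i=0}^{\ell}\binom{[n]}{n-i}$.
   Context: A family $\mathcal{A}$ is a finite family of distinct finite sets, at least one of which is nonempty. Its universe is $U(\mathcal{A})=\bigcup_{A\in\mathcal{A}}A$. $\mathcal{A}$ is union-closed if $X_1,X_2\in\mathcal{A}$ implies $X_1\cup X_2\in\mathcal{A}$. A chain in $\mathcal{A}$ is a subfamily any two of whose members are comparable under inclusion; the length $\ell(\mathcal{A})$ of $\mathcal{A}$ is one less than the maximum size of a chain in $\mathcal{A}$. For a set $S$, $\binom{S}{r}$ denotes the family of $r$-element subsets of $S$. *)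

theory Defs
  imports "HOL-Library.Ramsey"
begin

definition set_family :: "'a set set \<Rightarrow> bool" where
  "set_family \<A> \<longleftrightarrow> finite \<A> \<and> (\<forall>A\<in>\<A>. finite A) \<and> (\<exists>A\<in>\<A>. A \<noteq> {})"

definition union_closed :: "'a set set \<Rightarrow> bool" where
  "union_closed \<A> \<longleftrightarrow> (\<forall>X\<in>\<A>. \<forall>Y\<in>\<A>. X \<union> Y \<in> \<A>)"

(* A nonempty family has a chain of size 1, so the truncated subtraction is exact. *)
definition family_length :: "'a set set \<Rightarrow> nat" where
  "family_length \<A> = Max (card ` chains \<A>) - 1"

end

theory Submission
  imports Defs
begin

text \<open>
  Let \<open>avoid_max \<A> T\<close> be the union of all members disjoint from \<open>T\<close>. Each \<open>X \<in> \<A>\<close> is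
  \<open>avoid_max \<A> T\<close> for \<open>T = U - X\<close>; shrink \<open>T\<close> to a minimal such set. Adding the elements of a minimal
  \<open>T\<close> one at a time makes \<open>avoid_max\<close> strictly decrease, which gives a chain of
  size \<open>|T| + 1\<close>, so \<open>|T| \<le> \<ell>\<close>. As \<open>T\<close> determines \<open>X\<close>, the bound follows.

  In the case of equality every \<open>T\<close> with \<open>|T| \<le> \<ell>\<close> arises, so \<open>avoid_max\<close> is injective on such sets.
  If \<open>avoid_max \<A> T\<close> misses some \<open>y \<in> U - T\<close>, then for \<open>|T| < \<ell>\<close> adding \<open>y\<close> to \<open>T\<close> contradicts injectivity, and
  for \<open>|T| = \<ell>\<close> exchanging an element of \<open>T\<close> for \<open>y\<close> gives a set whose chain of size \<open>\<ell> + 1\<close> can be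
  prolonged by \<open>avoid_max \<A> T\<close>. Hence \<open>U - T = avoid_max \<A> T \<in> \<A>\<close>.
\<close>

text \<open>If no member avoids \<open>T\<close>, the union is empty and the value \<open>{}\<close>
  need not lie in \<open>\<A>\<close>.\<close>

definition avoid_max :: "'a set set \<Rightarrow> 'a set \<Rightarrow> 'a set" where
  "avoid_max \<A> T = \<Union>{A \<in> \<A>. A \<inter> T = {}}"

lemma avoid_max_disjoint: "avoid_max \<A> T \<inter> T = {}"
  unfolding avoid_max_def by blast

lemma avoid_max_subset: "avoid_max \<A> T \<subseteq> \<Union>\<A>"
  unfolding avoid_max_def by blast

lemma avoid_max_upper: "A \<in> \<A> \<Longrightarrow> A \<inter> T = {} \<Longrightarrow> A \<subseteq> avoid_max \<A> T"
  unfolding avoid_max_def by blast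

lemma avoid_max_antimono: "S \<subseteq> T \<Longrightarrow> avoid_max \<A> T \<subseteq> avoid_max \<A> S"
  unfolding avoid_max_def by blast

lemma union_closed_Union:
  assumes "union_closed \<A>" "finite \<B>" "\<B> \<noteq> {}" "\<B> \<subseteq> \<A>"
  shows "\<Union>\<B> \<in> \<A>"
  using assms(2-4)
proof (induction \<B> rule: finite_ne_induct)
  case (singleton x)
  then show ?case by simp
next
  case (insert x F)
  then show ?case using assms(1) by (simp add: union_closed_def)
qed

lemma avoid_max_in:
  assumes "union_closed \<A>" "finite \<A>" "A \<in> \<A>" "A \<inter> T = {}"
  shows "avoid_max \<A> T \<in> \<A>"
  unfolding avoid_max_def
  by (rule union_closed_Union[OF assms(1)]) (use assms in auto)

lemma card_chain_le:
  assumes "finite \<A>" "C \<in> chains \<A>"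
  shows "card C \<le> Suc (family_length \<A>)"
proof -
  have "chains \<A> \<subseteq> Pow \<A>" by (auto simp: chains_def)
  then have "finite (chains \<A>)" using assms(1) finite_subset by blast
  then have "card C \<le> Max (card ` chains \<A>)" using assms(2) by simp
  then show ?thesis by (simp add: family_length_def)
qed

text \<open>The members of a chain have distinct cardinalities between 0 and \<open>card U\<close>.
  The bound makes \<open>n - i\<close> an exact subtraction for \<open>i \<le> l\<close>.\<close>

lemma family_length_le_card:
  assumes "finite U" "\<A> \<subseteq> Pow U"
  shows "family_length \<A> \<le> card U"
proof -
  have fin: "finite \<A>" using assms by (meson finite_Pow_iff finite_subset)
  have "chains \<A> \<subseteq> Pow \<A>" by (auto simp: chains_def)
  then have fc: "finite (chains \<A>)" using fin finite_subset by blast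
  have ne: "chains \<A> \<noteq> {}" by (auto simp: chains_def chain_subset_def)
  have "card C \<le> Suc (card U)" if C: "C \<in> chains \<A>" for C
  proof -
    have sub: "X \<subseteq> U" if "X \<in> C" for X using C that assms(2) by (auto simp: chains_def)
    have "inj_on card C"
    proof (rule inj_onI)
      fix X Y assume XY: "X \<in> C" "Y \<in> C" "card X = card Y"
      then have "finite X" "finite Y" using sub assms(1) finite_subset by blast+
      moreover have "X \<subseteq> Y \<or> Y \<subseteq> X"
        using C XY by (auto simp: chains_def chain_subset_def)
      ultimately show "X = Y" using XY(3) by (metis card_subset_eq)
    qed
    moreover have "card ` C \<subseteq> {..card U}"
      using sub assms(1) by (auto intro: card_mono)
    ultimately have "card C \<le> card {..card U}" by (intro card_inj_on_le) auto
    then show ?thesis by simp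
  qed
  then have "Max (card ` chains \<A>) \<le> Suc (card U)" using fc ne by simp
  then show ?thesis by (simp add: family_length_def)
qed

text \<open>The last conjunct allows a smaller set to be put below the chain, in the induction and
  again in \<open>avoid_max_eq_compl\<close>.\<close>

lemma chain_of_avoid_max:
  assumes "finite I"
    and "\<And>T. T \<subseteq> I \<Longrightarrow> avoid_max \<A> T \<in> \<A>"
    and "\<And>T x. insert x T \<subseteq> I \<Longrightarrow> x \<notin> T \<Longrightarrow> avoid_max \<A> (insert x T) \<noteq> avoid_max \<A> T"
  shows "\<exists>C \<in> chains \<A>. finite C \<and> card C = Suc (card I) \<and> (\<forall>X\<in>C. avoid_max \<A> I \<subseteq> X)"
  using assms
proof (induction I rule: finite_induct)
  case empty
  then show ?case
    by (intro bexI[of _ "{avoid_max \<A> {}}"]) (auto simp: chains_def chain_subset_def)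
next
  case (insert x F)
  have "\<exists>C \<in> chains \<A>. finite C \<and> card C = Suc (card F) \<and> (\<forall>X\<in>C. avoid_max \<A> F \<subseteq> X)"
    by (rule insert.IH) (blast intro: insert.prems, use insert.prems(2) in blast)
  then obtain C where C: "C \<in> chains \<A>" "finite C" "card C = Suc (card F)"
      "\<forall>X\<in>C. avoid_max \<A> F \<subseteq> X" by blast
  let ?Y = "avoid_max \<A> (insert x F)"
  have "?Y \<noteq> avoid_max \<A> F" using insert.prems(2)[of x F] insert.hyps by blast
  moreover have "?Y \<subseteq> avoid_max \<A> F" by (rule avoid_max_antimono) blast
  ultimately have Y: "?Y \<subset> avoid_max \<A> F" by blast
  then have "?Y \<notin> C" and below: "\<forall>X\<in>C. ?Y \<subseteq> X" using C(4) by blast+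
  moreover have "?Y \<in> \<A>" using insert.prems(1) by blast
  moreover have "insert ?Y C \<in> chains \<A>"
    using C(1) below \<open>?Y \<in> \<A>\<close> unfolding chains_def chain_subset_def by blast
  ultimately show ?case
    using C insert.hyps by (intro bexI[of _ "insert ?Y C"]) auto
qed

lemma exists_small_avoiding_set:
  assumes uc: "union_closed \<A>" and fin: "finite \<A>" and finU: "finite (\<Union>\<A>)" and X: "X \<in> \<A>"
  shows "\<exists>I. I \<subseteq> \<Union>\<A> \<and> card I \<le> family_length \<A> \<and> avoid_max \<A> I = X"
proof -
  let ?P = "\<lambda>I. I \<subseteq> \<Union>\<A> \<and> avoid_max \<A> I = X"
  \<comment> \<open>The members avoiding \<open>\<Union>\<A> - X\<close> are those contained in
    \<open>X\<close>, and \<open>X\<close> is one of them.\<close>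
  have "avoid_max \<A> (\<Union>\<A> - X) = X"
    using X unfolding avoid_max_def by blast
  then have "?P (\<Union>\<A> - X)" by blast
  then obtain I where I: "?P I" and min: "\<And>J. ?P J \<Longrightarrow> card I \<le> card J"
    using ex_has_least_nat[of ?P _ card] by metis
  have finI: "finite I" using I finU finite_subset by blast
  have XI: "X \<inter> I = {}" using I avoid_max_disjoint[of \<A> I] by simp
  have strict: "avoid_max \<A> (insert x T) \<noteq> avoid_max \<A> T"
    if xT: "insert x T \<subseteq> I" "x \<notin> T" for x T
  proof
    assume eq: "avoid_max \<A> (insert x T) = avoid_max \<A> T"
    have "A \<inter> I = {}" if A: "A \<in> \<A>" "A \<inter> (I - {x}) = {}" for A
    proof -
      have "A \<subseteq> avoid_max \<A> T" using A xT by (intro avoid_max_upper) auto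
      then have "x \<notin> A" using eq avoid_max_disjoint[of \<A> "insert x T"] by blast
      then show ?thesis using A by blast
    qed
    then have "avoid_max \<A> (I - {x}) = avoid_max \<A> I"
      unfolding avoid_max_def by (intro arg_cong[of _ _ Union]) auto
    then have "card I \<le> card (I - {x})" using I by (intro min) auto
    moreover have "x \<in> I" using xT by blast
    ultimately show False using finI by (metis card_Diff1_less not_less)
  qed
  have "avoid_max \<A> T \<in> \<A>" if "T \<subseteq> I" for T
    using that XI by (intro avoid_max_in[OF uc fin X]) auto
  then obtain C where "C \<in> chains \<A>" "card C = Suc (card I)"
    using chain_of_avoid_max[OF finI, of \<A>] strict by blast
  then have "card I \<le> family_length \<A>" using card_chain_le[OF fin, of C] by simp
  then show ?thesis using I by blast
qed

lemma card_subsets_card_le: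
  assumes "finite U"
  shows "card {T. T \<subseteq> U \<and> card T \<le> l} = (\<Sum>i=0..l. card U choose i)"
proof -
  have "{T. T \<subseteq> U \<and> card T \<le> l} = (\<Union>i\<in>{0..l}. {T. T \<subseteq> U \<and> card T = i})" by auto
  also have "card \<dots> = (\<Sum>i=0..l. card {T. T \<subseteq> U \<and> card T = i})"
    by (rule card_UN_disjoint) (use assms in auto)
  finally show ?thesis using n_subsets[OF assms] by simp
qed

lemma complements_of_small_subsets:
  assumes "finite U" "l \<le> card U"
  shows "(\<lambda>T. U - T) ` {T. T \<subseteq> U \<and> card T \<le> l} = (\<Union>i\<in>{0..l}. nsets U (card U - i))"
proof (intro equalityI subsetI)
  fix X assume "X \<in> (\<lambda>T. U - T) ` {T. T \<subseteq> U \<and> card T \<le> l}"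
  then obtain T where T: "T \<subseteq> U" "card T \<le> l" "X = U - T" by blast
  then have "X \<in> nsets U (card U - card T)"
    using assms(1) by (auto simp: nsets_def card_Diff_subset finite_subset)
  then show "X \<in> (\<Union>i\<in>{0..l}. nsets U (card U - i))" using T(2) by auto
next
  fix X assume "X \<in> (\<Union>i\<in>{0..l}. nsets U (card U - i))"
  then obtain i where i: "i \<le> l" "X \<subseteq> U" "card X = card U - i" by (auto simp: nsets_def)
  then have "card (U - X) \<le> l"
    using assms by (simp add: card_Diff_subset finite_subset)
  moreover have "X = U - (U - X)" using i by blast
  ultimately show "X \<in> (\<lambda>T. U - T) ` {T. T \<subseteq> U \<and> card T \<le> l}" by blast
qed

text \<open>The hypotheses \<open>mem\<close> and \<open>inj\<close> are what the case of equality
  supplies.\<close>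

lemma avoid_max_eq_compl:
  assumes fin: "finite \<A>" and finU: "finite (\<Union>\<A>)"
    and mem: "\<And>T. T \<subseteq> \<Union>\<A> \<Longrightarrow> card T \<le> family_length \<A> \<Longrightarrow> avoid_max \<A> T \<in> \<A>"
    and inj: "inj_on (avoid_max \<A>) {T. T \<subseteq> \<Union>\<A> \<and> card T \<le> family_length \<A>}"
    and T: "T \<subseteq> \<Union>\<A>" "card T \<le> family_length \<A>"
  shows "avoid_max \<A> T = \<Union>\<A> - T"
proof (rule ccontr)
  let ?l = "family_length \<A>"
  assume "avoid_max \<A> T \<noteq> \<Union>\<A> - T"
  then obtain y where y: "y \<in> \<Union>\<A>" "y \<notin> T" "y \<notin> avoid_max \<A> T"
    using avoid_max_disjoint[of \<A> T] avoid_max_subset[of \<A> T] by blast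
  have finT: "finite T" using T finU finite_subset by blast
  \<comment> \<open>A member avoiding \<open>T\<close> lies in \<open>avoid_max \<A> T\<close>, so
    it misses \<open>y\<close> too and avoids all of \<open>insert y T\<close>.\<close>
  have avoid_y: "avoid_max \<A> T \<subseteq> avoid_max \<A> S" if "S \<subseteq> insert y T" for S
  proof -
    have "A \<subseteq> avoid_max \<A> S" if A: "A \<in> \<A>" "A \<inter> T = {}" for A
      using avoid_max_upper[OF A] A y \<open>S \<subseteq> insert y T\<close> by (intro avoid_max_upper) auto
    then show ?thesis by (auto simp: avoid_max_def)
  qed
  show False
  proof (cases "card T < ?l")
    case True
    have "avoid_max \<A> (insert y T) = avoid_max \<A> T"
      using avoid_y[of "insert y T"] avoid_max_antimono[of T "insert y T" \<A>] by blast
    then have "insert y T = T"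
      by (rule inj_onD[OF inj]) (use True T y finT in auto)
    then show False using y by blast
  next
    case False
    \<comment> \<open>Every member avoids \<open>{}\<close>, so \<open>avoid_max \<A> {}\<close> is
      the whole universe and contains \<open>y\<close>.\<close>
    have "T \<noteq> {}" using y by (auto simp: avoid_max_def)
    then obtain t where t: "t \<in> T" by blast
    \<comment> \<open>The exchange keeps the size at \<open>?l\<close>, so \<open>inj\<close> still
      applies to \<open>S\<close>, and keeps \<open>S\<close> inside \<open>insert y T\<close>, so
      \<open>avoid_y\<close> applies.\<close>
    define S where "S = insert y (T - {t})"
    have cS: "card S = ?l" using False T(2) t y finT card_Suc_Diff1[OF finT t] by (simp add: S_def)
    have S: "S \<subseteq> \<Union>\<A>" "finite S" using T y finT by (auto simp: S_def)
    have card_sub: "card R \<le> ?l" if "R \<subseteq> S" for R using card_mono[OF S(2) that] cS by simp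
    have sub: "avoid_max \<A> R \<in> \<A>" if "R \<subseteq> S" for R
      using that S(1) card_sub by (intro mem) auto
    have "avoid_max \<A> (insert x R) \<noteq> avoid_max \<A> R" if "insert x R \<subseteq> S" "x \<notin> R" for x R
    proof
      assume eq: "avoid_max \<A> (insert x R) = avoid_max \<A> R"
      have "insert x R = R"
        by (rule inj_onD[OF inj eq]) (use that S(1) card_sub in auto)
      then show False using that(2) by blast
    qed
    then obtain C where C: "C \<in> chains \<A>" "finite C" "card C = Suc ?l"
        "\<forall>X\<in>C. avoid_max \<A> S \<subseteq> X"
      using chain_of_avoid_max[OF S(2), of \<A>] sub cS by metis
    have "S \<noteq> T" using y by (auto simp: S_def)
    then have "avoid_max \<A> T \<noteq> avoid_max \<A> S"
      using inj_onD[OF inj, of T S] T S(1) cS by auto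
    then have less: "avoid_max \<A> T \<subset> avoid_max \<A> S"
      using avoid_y[of S] by (auto simp: S_def)
    then have new: "avoid_max \<A> T \<notin> C" and below: "\<forall>X\<in>C. avoid_max \<A> T \<subseteq> X"
      using C(4) by blast+
    \<comment> \<open>This chain has \<open>?l + 2\<close> members, one more than the length
      allows.\<close>
    have "insert (avoid_max \<A> T) C \<in> chains \<A>"
      using C(1) below mem[OF T] unfolding chains_def chain_subset_def by blast
    then have "card (insert (avoid_max \<A> T) C) \<le> Suc ?l" by (rule card_chain_le[OF fin])
    then show False using new C by simp
  qed
qed

theorem theorem1:
  fixes n l :: nat and \<A> :: "nat set set"
  assumes "n \<ge> 1"
    and "set_family \<A>"
    and "union_closed \<A>"
    and "\<Union>\<A> = {1..n}"
    and "family_length \<A> = l"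
  shows "card \<A> \<le> (\<Sum>i=0..l. n choose i) \<and>
    (card \<A> = (\<Sum>i=0..l. n choose i) \<longleftrightarrow> \<A> = (\<Union>i\<in>{0..l}. nsets {1..n} (n - i)))"
proof -
  have fin: "finite \<A>" using assms(2) by (simp add: set_family_def)
  have finU: "finite (\<Union>\<A>)" and cU: "card (\<Union>\<A>) = n" using assms(4) by auto
  have ln: "l \<le> card (\<Union>\<A>)"
    using family_length_le_card[OF finU, of \<A>] assms(5) by auto
  define P where "P = {T. T \<subseteq> \<Union>\<A> \<and> card T \<le> l}"
  have finP: "finite P" using finU by (simp add: P_def)
  have cP: "card P = (\<Sum>i=0..l. n choose i)"
    using card_subsets_card_le[OF finU, of l] cU by (simp add: P_def)
  \<comment> \<open>The extremal family consists of the complements of the sets in \<open>P\<close>,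
    so it has \<open>card P\<close> members.\<close>
  have compl: "(\<lambda>T. \<Union>\<A> - T) ` P = (\<Union>i\<in>{0..l}. nsets {1..n} (n - i))"
    using complements_of_small_subsets[OF finU ln] cU assms(4) by (simp add: P_def)
  have "inj_on (\<lambda>T. \<Union>\<A> - T) P" by (rule inj_onI) (auto simp: P_def)
  then have cN: "card (\<Union>i\<in>{0..l}. nsets {1..n} (n - i)) = card P"
    using card_image compl by metis
  obtain b where b: "\<And>X. X \<in> \<A> \<Longrightarrow> b X \<in> P \<and> avoid_max \<A> (b X) = X"
    using exists_small_avoiding_set[OF assms(3) fin finU] assms(5)
    unfolding P_def mem_Collect_eq by metis
  have injb: "inj_on b \<A>" by (rule inj_onI) (metis b)
  have le: "card \<A> \<le> card P" using card_inj_on_le[OF injb _ finP] b by blast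
  have "\<A> = (\<Union>i\<in>{0..l}. nsets {1..n} (n - i))" if eq: "card \<A> = card P"
  proof -
    \<comment> \<open>Equal cardinalities make the injection \<open>b\<close> onto \<open>P\<close>;
      its left inverse \<open>avoid_max \<A>\<close> then maps \<open>P\<close> injectively into
      \<open>\<A>\<close>.\<close>
    have img: "b ` \<A> = P"
      using b eq by (intro card_subset_eq[OF finP]) (auto simp: card_image[OF injb])
    have mem: "avoid_max \<A> T \<in> \<A>" if "T \<in> P" for T using that img b by force
    have inj: "inj_on (avoid_max \<A>) P"
      unfolding img[symmetric] by (rule inj_onI) (use b in auto)
    have "avoid_max \<A> T = \<Union>\<A> - T" if "T \<in> P" for T
      by (rule avoid_max_eq_compl[OF fin finU])
        (use mem inj that assms(5) in \<open>auto simp: P_def\<close>)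
    \<comment> \<open>The extremal family is thus contained in \<open>\<A>\<close> and has the same
      finite size.\<close>
    then have "(\<lambda>T. \<Union>\<A> - T) ` P \<subseteq> \<A>" using mem by force
    then show ?thesis using compl cN eq card_subset_eq[OF fin] by metis
  qed
  then show ?thesis using le cP cN by auto
qed

end
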